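(* Let $P$ be a general logic program, $G_0=\leftarrow A_0$ a top goal with $A_0$ an atom, and $R$ the depth-first, left-most control strategy. A generalized SLDNF-derivation $D$ in the generalized SLDNF-tree for $P\cup\{G_0\}$ via $R$ is infinite if and only if it is of the form $N_0:G_0\Rightarrow\cdots N_{g_1}:G_{g_1}\Rightarrow\cdots N_{g_2}:G_{g_2}\Rightarrow\cdots N_{g_3}:G_{g_3}\Rightarrow\cdots$ with infinitely many nodes $N_{g_1},N_{g_2},\dots$ such that for every $j\ge1$, $G_{g_{j+1}}$ is a loop goal of $G_{g_j}$.
   Context: A general logic program is a finite set of clauses $A\leftarrow L_1,\dots,L_n$ ($A$ an atom, the $L_i$ literals). The depth-first, left-most control strategy selects the leftmost literal of a goal, tries clauses in textual order and expands nodes depth-first. Nodes are $N_i:G_i$; each literal $L$ in the goal at node $M$ carries an ancestor list $AL_{L@M}$ (a set of pairs (node name, subgoal)). SLDNF$^*$-tree $T_{N_r:G_r}$ for $P\cup\{G_r\}$, $G_r=\leftarrow A_r$, with given $AL_{A_r@N_r}$: root $N_r:G_r$; completed once a node marked LAST is generated or all leaves are marked $\Box_t,\Box_f,\Box_{fl}$. For a node $N_i:\leftarrow L_1,\dots,L_m$: if $m=0$ it is a success leaf $\Box_t$, additionally marked LAST if $AL_{A_r@N_r}\ne\emptyset$. If $L_1$ is positive: for each clause $B\leftarrow B_1,\dots,B_n$ with $B$ unifiable with $L_1$ (mgu $\theta$), a child $N_s:\leftarrow(B_1,\dots,B_n,L_2,\dots,L_m)\theta$ with $AL_{B_k\theta@N_s}=\{(N_i,L_1)\}\cup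 AL_{L_1@N_i}$ and $AL_{L_k\theta@N_s}=AL_{L_k@N_i}$; if none unifies, a single child $\Box_f$. If $L_1=\neg A$ is ground: build the subsidiary SLDNF$^*$-tree $T_{N_{i+1}:\leftarrow A}$ with $AL_{A@N_{i+1}}=AL_{L_1@N_i}$; if it has a success leaf, single child $\Box_f$; else if it has a flounder leaf, single child $\Box_{fl}$; else if all branches end in failure leaves, single child $N_s:\leftarrow L_2,\dots,L_m$ with inherited ancestor lists; otherwise $N_i$ has no child and is marked LAST. If $L_1$ is non-ground negative: single child $\Box_{fl}$. The generalized SLDNF-tree for $P\cup\{G_0\}$ via $R$ consists of $T_{N_0:G_0}$ with $AL_{A_0@N_0}=\emptyset$ together with all its descendant (subsidiary, recursively) SLDNF$^*$-trees, a node with ground negative selected literal $\neg A$ being connected by a dotted edge to the root $\leftarrow A$ of its subsidiary tree. A generalized SLDNF-derivation is a path in it starting at $N_0:G_0$ following tree edges and dotted edges ($\Rightarrow$ denotes either kind of edge). For a node $N_i:G_i$, $L_i^1$ is its selected (leftmost) subgoal; $L_i^1\prec_{anc}L_k^1$ means $(N_i,L_i^1)\in AL_{L_k^1@N_k}$. Symbol string $S_T$ of a term/atom $T$: the string of all predicate symbols, function symbols, constants and variables of $T$ read left to right, every variable replaced by the symbol $\mathcal{X}$ (list symbols $[$, $]$, $|$ count as function symbols). $S_1\subseteq_{proj}S_2$ means $S_1$ is obtained from $S_2$ by deleting zero or more elements. For atoms $A_1=p(\ldots)$, $A_2=p(\ldots)$ with the same predicate symbol, $A_1\leadsto_{loop}A_2$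 means $S_{A_1}\subseteq_{proj}S_{A_2}$. For nodes $N_i:G_i$, $N_j:G_j$ in a generalized SLDNF-derivation with $L_i^1\prec_{anc}L_j^1$ and $L_i^1\leadsto_{loop}L_j^1$, $G_j$ is called a loop goal of $G_i$. *)

theory Defs
  imports Main "HOL-Library.Extended_Nat" "HOL-Library.Sublist" "HOL-Library.Infinite_Typeclass"
begin

section \<open>General logic programs\<close>

text \<open>
  Lists have constructors of their own because their symbols are written around the arguments:
  \<open>LCons s t\<close> is the list term \<open>[s|t]\<close> and \<open>LNil\<close> is \<open>[]\<close>. Constants are function symbols applied
  to no argument.
\<close>

datatype ('f, trm_vars: 'v) trm =
    Var 'v
  | Fn 'f "('f, 'v) trm list"
  | LNil
  | LCons "('f, 'v) trm" "('f, 'v) trm"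

datatype ('p, 'f, atom_vars: 'v) atom =
  Atom (pred_sym: 'p) (args: "('f, 'v) trm list")

datatype ('p, 'f, lit_vars: 'v) literal =
    Pos "('p, 'f, 'v) atom"
  | Neg "('p, 'f, 'v) atom"

datatype ('p, 'f, clause_vars: 'v) clause =
  Clause (head: "('p, 'f, 'v) atom") (body: "('p, 'f, 'v) literal list")

text \<open>A general logic program is a list of clauses: finitely many, in textual order.\<close>

type_synonym ('p, 'f, 'v) program = "('p, 'f, 'v) clause list"

definition ground_atom :: "('p, 'f, 'v) atom \<Rightarrow> bool" where
  "ground_atom A \<longleftrightarrow> atom_vars A = {}"

section \<open>Substitutions and unification\<close>

type_synonym ('f, 'v) subst = "'v \<Rightarrow> ('f, 'v) trm"

primrec subst_trm :: "('f, 'v) subst \<Rightarrow> ('f, 'v) trm \<Rightarrow> ('f, 'v) trm" where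
  "subst_trm \<sigma> (Var x) = \<sigma> x"
| "subst_trm \<sigma> (Fn f ts) = Fn f (map (subst_trm \<sigma>) ts)"
| "subst_trm \<sigma> LNil = LNil"
| "subst_trm \<sigma> (LCons s t) = LCons (subst_trm \<sigma> s) (subst_trm \<sigma> t)"

primrec subst_atom :: "('f, 'v) subst \<Rightarrow> ('p, 'f, 'v) atom \<Rightarrow> ('p, 'f, 'v) atom" where
  "subst_atom \<sigma> (Atom p ts) = Atom p (map (subst_trm \<sigma>) ts)"

primrec subst_lit :: "('f, 'v) subst \<Rightarrow> ('p, 'f, 'v) literal \<Rightarrow> ('p, 'f, 'v) literal" where
  "subst_lit \<sigma> (Pos A) = Pos (subst_atom \<sigma> A)"
| "subst_lit \<sigma> (Neg A) = Neg (subst_atom \<sigma> A)"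

definition unifiable :: "('p, 'f, 'v) atom \<Rightarrow> ('p, 'f, 'v) atom \<Rightarrow> bool" where
  "unifiable A B \<longleftrightarrow> (\<exists>\<sigma>. subst_atom \<sigma> A = subst_atom \<sigma> B)"

definition is_mgu :: "('f, 'v) subst \<Rightarrow> ('p, 'f, 'v) atom \<Rightarrow> ('p, 'f, 'v) atom \<Rightarrow> bool" where
  "is_mgu \<theta> A B \<longleftrightarrow>
     subst_atom \<theta> A = subst_atom \<theta> B \<and>
     (\<forall>\<sigma>. subst_atom \<sigma> A = subst_atom \<sigma> B \<longrightarrow> (\<exists>\<delta>. \<forall>x. \<sigma> x = subst_trm \<delta> (\<theta> x)))"

definition variant_of :: "('p, 'f, 'v) clause \<Rightarrow> ('p, 'f, 'v) clause \<Rightarrow> bool" where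
  "variant_of C' C \<longleftrightarrow>
     (\<exists>\<rho>. inj_on \<rho> (clause_vars C) \<and> C' = map_clause id id \<rho> C)"

section \<open>Nodes\<close>

text \<open>
  A node is named by the path that leads to it from the top node, whose name is \<open>[]\<close>: \<open>N @ [Br k]\<close>
  is a child of \<open>N\<close> in the same SLDNF*-tree, and \<open>N @ [Sub]\<close> is the root of the subsidiary
  SLDNF*-tree of \<open>N\<close>, i.e. the target of the dotted edge from \<open>N\<close>. At a node with a positive
  selected literal \<open>k\<close> is the position in the program of the clause that is used; an only child
  introduced in the other cases has \<open>k = 0\<close>.
\<close>

datatype step = Br nat | Sub

type_synonym name = "step list"

type_synonym ('p, 'f, 'v) anc_list = "(name \<times> ('p, 'f, 'v) literal) set"

text \<open>
  Every literal occurrence in a goal comes with its ancestor list. \<open>Goal []\<close> is the empty goal,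
  hence a success leaf; the two other constructors are the marked failure and flounder leaves.
\<close>

datatype ('p, 'f, 'v) content =
    Goal "(('p, 'f, 'v) literal \<times> ('p, 'f, 'v) anc_list) list"
  | FailLeaf
  | FlounderLeaf

text \<open>
  A tree assigns contents to the names of the nodes that are generated. It comprises the main
  SLDNF*-tree and all its descendant subsidiary trees.
\<close>

type_synonym ('p, 'f, 'v) gtree = "name \<Rightarrow> ('p, 'f, 'v) content option"

definition goal_vars :: "(('p, 'f, 'v) literal \<times> ('p, 'f, 'v) anc_list) list \<Rightarrow> 'v set" where
  "goal_vars gs = (\<Union>(L, al) \<in> set gs. lit_vars L)"

section \<open>Properties of a single SLDNF*-tree\<close>

text \<open>The names \<open>below r ks\<close> are those in the SLDNF*-tree (or subtree of one) rooted at \<open>r\<close>.\<close>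

abbreviation below :: "name \<Rightarrow> nat list \<Rightarrow> name" where
  "below r ks \<equiv> r @ map Br ks"

definition has_success_leaf :: "('p, 'f, 'v) gtree \<Rightarrow> name \<Rightarrow> bool" where
  "has_success_leaf T r \<longleftrightarrow> (\<exists>ks. T (below r ks) = Some (Goal []))"

definition has_flounder_leaf :: "('p, 'f, 'v) gtree \<Rightarrow> name \<Rightarrow> bool" where
  "has_flounder_leaf T r \<longleftrightarrow> (\<exists>ks. T (below r ks) = Some FlounderLeaf)"

definition has_infinite_branch :: "('p, 'f, 'v) gtree \<Rightarrow> name \<Rightarrow> bool" where
  "has_infinite_branch T r \<longleftrightarrow> (\<exists>b. \<forall>n. below r (map b [0..<n]) \<in> dom T)"

definition childless :: "('p, 'f, 'v) gtree \<Rightarrow> name \<Rightarrow> bool" where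
  "childless T N \<longleftrightarrow> N \<in> dom T \<and> (\<forall>k. N @ [Br k] \<notin> dom T)"

definition all_branches_fail :: "('p, 'f, 'v) gtree \<Rightarrow> name \<Rightarrow> bool" where
  "all_branches_fail T r \<longleftrightarrow>
     \<not> has_infinite_branch T r \<and>
     (\<forall>ks. childless T (below r ks) \<longrightarrow> T (below r ks) = Some FailLeaf)"

text \<open>
  The two kinds of nodes marked LAST: success leaves of an SLDNF*-tree whose root subgoal has a
  nonempty ancestor list, and nodes with a ground negative selected literal whose subsidiary tree
  falls under none of the three cases that give the node a child.
\<close>

inductive is_last :: "('p, 'f, 'v) gtree \<Rightarrow> name \<Rightarrow> bool" for T where
  last_success:
    "T r = Some (Goal [(Pos A, al)]) \<Longrightarrow> r = [] \<or> last r = Sub \<Longrightarrow> al \<noteq> {} \<Longrightarrow>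
     T (below r ks) = Some (Goal []) \<Longrightarrow> is_last T (below r ks)"
| last_stuck:
    "T N = Some (Goal ((Neg A, al) # gs)) \<Longrightarrow> ground_atom A \<Longrightarrow>
     \<not> has_success_leaf T (N @ [Sub]) \<Longrightarrow> \<not> has_flounder_leaf T (N @ [Sub]) \<Longrightarrow>
     \<not> all_branches_fail T (N @ [Sub]) \<Longrightarrow> is_last T N"

section \<open>Generalized SLDNF-trees\<close>

text \<open>
  \<open>child P T N k c\<close>: the expansion of \<open>N\<close> gives it a \<open>k\<close>-th child with content \<open>c\<close>. The clause is
  standardized apart from the goal; the choice of the variant and of the mgu is left open.
\<close>

inductive child :: "('p, 'f, 'v) program \<Rightarrow> ('p, 'f, 'v) gtree \<Rightarrow> name \<Rightarrow> nat \<Rightarrow>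
    ('p, 'f, 'v) content \<Rightarrow> bool" for P T where
  child_resolvent:
    "T N = Some (Goal ((Pos A, al) # gs)) \<Longrightarrow> k < length P \<Longrightarrow> variant_of C (P ! k) \<Longrightarrow>
     clause_vars C \<inter> goal_vars ((Pos A, al) # gs) = {} \<Longrightarrow> is_mgu \<theta> A (head C) \<Longrightarrow>
     child P T N k (Goal (map (\<lambda>B. (subst_lit \<theta> B, insert (N, Pos A) al)) (body C)
                          @ map (\<lambda>(L, al'). (subst_lit \<theta> L, al')) gs))"
| child_no_clause:
    "T N = Some (Goal ((Pos A, al) # gs)) \<Longrightarrow>
     \<not> (\<exists>C C'. C \<in> set P \<and> variant_of C' C \<and>
              clause_vars C' \<inter> goal_vars ((Pos A, al) # gs) = {} \<and> unifiable A (head C')) \<Longrightarrow>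
     child P T N 0 FailLeaf"
| child_neg_success:
    "T N = Some (Goal ((Neg A, al) # gs)) \<Longrightarrow> ground_atom A \<Longrightarrow>
     has_success_leaf T (N @ [Sub]) \<Longrightarrow>
     child P T N 0 FailLeaf"
| child_neg_flounder:
    "T N = Some (Goal ((Neg A, al) # gs)) \<Longrightarrow> ground_atom A \<Longrightarrow>
     \<not> has_success_leaf T (N @ [Sub]) \<Longrightarrow> has_flounder_leaf T (N @ [Sub]) \<Longrightarrow>
     child P T N 0 FlounderLeaf"
| child_neg_fail:
    "T N = Some (Goal ((Neg A, al) # gs)) \<Longrightarrow> ground_atom A \<Longrightarrow>
     all_branches_fail T (N @ [Sub]) \<Longrightarrow>
     child P T N 0 (Goal gs)"
| child_nonground:
    "T N = Some (Goal ((Neg A, al) # gs)) \<Longrightarrow> \<not> ground_atom A \<Longrightarrow>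
     child P T N 0 FlounderLeaf"

inductive subsidiary_root :: "('p, 'f, 'v) gtree \<Rightarrow> name \<Rightarrow> ('p, 'f, 'v) content \<Rightarrow> bool"
  for T where
  "T N = Some (Goal ((Neg A, al) # gs)) \<Longrightarrow> ground_atom A \<Longrightarrow>
   subsidiary_root T N (Goal [(Pos A, al)])"

text \<open>
  Depth-first control: the \<open>k\<close>-th child of a generated node is generated once the subtrees of all
  earlier children have been completed, which never happens if one of them has an infinite branch
  or contains a node marked LAST. (Siblings of the ancestors need not be mentioned, since the node
  itself has been generated only after those to its left were completed.)
\<close>

definition reached :: "('p, 'f, 'v) gtree \<Rightarrow> name \<Rightarrow> nat \<Rightarrow> bool" where
  "reached T N k \<longleftrightarrow>
     (\<forall>j < k. \<not> has_infinite_branch T (N @ [Br j]) \<and> (\<forall>ks. \<not> is_last T (below (N @ [Br j]) ks)))"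

text \<open>
  \<open>T\<close> is a generalized SLDNF-tree for \<open>P\<close> and the top goal \<open>\<leftarrow> A0\<close> via the depth-first, left-most
  control strategy. \<open>T\<close> need not be unique: variants and mgus are arbitrary, and when subsidiary
  trees are nested infinitely deep, the clauses for negative nodes are not well-founded and do not
  determine which case applies. No particular solution is singled out.
\<close>

definition generalized_sldnf_tree ::
    "('p, 'f, 'v) program \<Rightarrow> ('p, 'f, 'v) atom \<Rightarrow> ('p, 'f, 'v) gtree \<Rightarrow> bool" where
  "generalized_sldnf_tree P A0 T \<longleftrightarrow>
     T [] = Some (Goal [(Pos A0, {})]) \<and>
     (\<forall>N c. T (N @ [Sub]) = Some c \<longleftrightarrow> subsidiary_root T N c) \<and>
     (\<forall>N k c. T (N @ [Br k]) = Some c \<longrightarrow> child P T N k c \<and> reached T N k) \<and>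
     (\<forall>N k. (\<exists>c. child P T N k c) \<and> reached T N k \<longrightarrow> N @ [Br k] \<in> dom T)"

definition edge :: "('p, 'f, 'v) gtree \<Rightarrow> name \<Rightarrow> name \<Rightarrow> bool" where
  "edge T M N \<longleftrightarrow> M \<in> dom T \<and> N \<in> dom T \<and> ((\<exists>k. N = M @ [Br k]) \<or> N = M @ [Sub])"

text \<open>
  A generalized SLDNF-derivation is a finite or infinite path \<open>D 0, D 1, \<dots>\<close> with \<open>len\<close> many nodes;
  values of \<open>D\<close> beyond \<open>len\<close> are irrelevant.
\<close>

definition generalized_sldnf_derivation ::
    "('p, 'f, 'v) gtree \<Rightarrow> enat \<Rightarrow> (nat \<Rightarrow> name) \<Rightarrow> bool" where
  "generalized_sldnf_derivation T len D \<longleftrightarrow>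
     0 < len \<and> D 0 = [] \<and> (\<forall>i. enat (Suc i) < len \<longrightarrow> edge T (D i) (D (Suc i)))"

section \<open>Loop goals\<close>

datatype ('p, 'f) symbol =
    PredSym 'p
  | FunSym 'f
  | VarSym
  | LBracket
  | RBracket
  | Bar

primrec trm_symbols :: "('f, 'v) trm \<Rightarrow> ('p, 'f) symbol list" where
  "trm_symbols (Var x) = [VarSym]"
| "trm_symbols (Fn f ts) = FunSym f # concat (map trm_symbols ts)"
| "trm_symbols LNil = [LBracket, RBracket]"
| "trm_symbols (LCons s t) = LBracket # trm_symbols s @ Bar # trm_symbols t @ [RBracket]"

primrec atom_symbols :: "('p, 'f, 'v) atom \<Rightarrow> ('p, 'f) symbol list" where
  "atom_symbols (Atom p ts) = PredSym p # concat (map trm_symbols ts)"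

definition leadsto_loop :: "('p, 'f, 'v) atom \<Rightarrow> ('p, 'f, 'v) atom \<Rightarrow> bool" where
  "leadsto_loop A1 A2 \<longleftrightarrow>
     pred_sym A1 = pred_sym A2 \<and> subseq (atom_symbols A1) (atom_symbols A2)"

text \<open>\<open>loop_goal T M N\<close>: the goal at node \<open>N\<close> is a loop goal of the goal at node \<open>M\<close>.\<close>

definition loop_goal :: "('p, 'f, 'v) gtree \<Rightarrow> name \<Rightarrow> name \<Rightarrow> bool" where
  "loop_goal T M N \<longleftrightarrow>
     (\<exists>A1 al1 gs1 A2 al2 gs2.
        T M = Some (Goal ((Pos A1, al1) # gs1)) \<and>
        T N = Some (Goal ((Pos A2, al2) # gs2)) \<and>
        (M, Pos A1) \<in> al2 \<and> leadsto_loop A1 A2)"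

end

(*
  Of the nodes of an infinite derivation, infinitely many have a positive selected literal that is
  an ancestor of the selected literal of every later node: keep all goals that wait for a
  subsidiary tree on one stack, and take the points at which this stack is never shorter later on.
  A most general unifier introduces no new function symbol, so all symbol strings are words over
  the finite alphabet of the program and the top goal, and Higman's lemma gives the loop goals.
*)

theory Submission
  imports Defs
begin

section \<open>Higman's lemma over a finite alphabet\<close>

definition bad_words :: "'a set \<Rightarrow> (nat \<Rightarrow> 'a list) \<Rightarrow> bool" where
  "bad_words F f \<longleftrightarrow> (\<forall>i. set (f i) \<subseteq> F) \<and> (\<forall>i j. i < j \<longrightarrow> \<not> subseq (f i) (f j))"

text \<open>Extendability to an infinite bad sequence is built in; a finite list that merely
  contains no embedded pair would not do, since a greedy choice of further words could get
  stuck.\<close>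

definition bad_prefix :: "'a set \<Rightarrow> 'a list list \<Rightarrow> bool" where
  "bad_prefix F ws \<longleftrightarrow> (\<exists>f. bad_words F f \<and> map f [0..<length ws] = ws)"

lemma bad_prefix_extend:
  assumes "bad_prefix F ws"
  shows "\<exists>w. bad_prefix F (ws @ [w])"
proof -
  from assms obtain f where "bad_words F f" "map f [0..<length ws] = ws"
    unfolding bad_prefix_def by blast
  then have "bad_prefix F (ws @ [f (length ws)])"
    unfolding bad_prefix_def by auto
  then show ?thesis ..
qed

text \<open>Nash-Williams' minimal bad sequence: each word is chosen as short as possible among
  those that keep the list so far extendable to a bad sequence.\<close>

lemma minimal_bad_words:
  assumes "bad_words F f"
  obtains g where "bad_words F g"
    and "\<And>n h. bad_words F h \<Longrightarrow> (\<And>i. i < n \<Longrightarrow> h i = g i) \<Longrightarrow> length (g n) \<le> length (h n)"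
proof -
  define pick where "pick ws = (ARG_MIN length w. bad_prefix F (ws @ [w]))" for ws
  define ws where "ws = rec_nat [] (\<lambda>_ us. us @ [pick us])"
  define g where "g n = pick (ws n)" for n
  have ws_Suc: "ws (Suc n) = ws n @ [g n]" and ws_0: "ws 0 = []" for n
    by (simp_all add: ws_def g_def)
  have ws_eq: "ws n = map g [0..<n]" for n
    by (induction n) (simp_all add: ws_0 ws_Suc)
  have prefix: "bad_prefix F (ws n)" for n
  proof (induction n)
    case 0
    then show ?case using assms by (auto simp: ws_0 bad_prefix_def)
  next
    case (Suc n)
    from bad_prefix_extend[OF this] obtain w where "bad_prefix F (ws n @ [w])" ..
    then show ?case unfolding ws_Suc g_def pick_def by (rule arg_min_natI)
  qed
  have agree: "\<exists>h. bad_words F h \<and> (\<forall>i<n. h i = g i)" for n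
    using prefix[of n] unfolding bad_prefix_def ws_eq by auto
  \<comment> \<open>Badness concerns at most two positions at a time, so it carries over from the
    bad sequences that agree with \<open>g\<close> on long enough initial segments.\<close>
  have "bad_words F g"
    unfolding bad_words_def
  proof (intro conjI allI impI)
    show "set (g i) \<subseteq> F" for i
      using agree[of "Suc i"] unfolding bad_words_def by (metis lessI)
    show "\<not> subseq (g i) (g j)" if "i < j" for i j
      using agree[of "Suc j"] that unfolding bad_words_def by (metis less_Suc_eq)
  qed
  moreover have "length (g n) \<le> length (h n)"
    if "bad_words F h" "\<And>i. i < n \<Longrightarrow> h i = g i" for n h
  proof -
    have "map h [0..<Suc n] = ws n @ [h n]"
      using that(2) by (simp add: ws_eq)
    then have "bad_prefix F (ws n @ [h n])"
      using that(1) unfolding bad_prefix_def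
      by (intro exI[of _ h]) (simp add: ws_eq del: map_append)
    then show ?thesis unfolding g_def pick_def by (rule arg_min_nat_le)
  qed
  ultimately show ?thesis by (rule that)
qed

lemma infinite_constant_subsequence:
  fixes c :: "nat \<Rightarrow> 'a"
  assumes "finite F" and "range c \<subseteq> F"
  obtains \<phi> :: "nat \<Rightarrow> nat" and a where "strict_mono \<phi>" "\<And>n. c (\<phi> n) = a"
proof -
  have "finite (range c)" using assms finite_subset by blast
  then obtain k where inf: "infinite {i. c i = c k}"
    using pigeonhole_infinite[of "UNIV :: nat set" c] by auto
  show ?thesis
  proof
    show "strict_mono (enumerate {i. c i = c k})"
      using inf by (rule strict_mono_enumerate)
    show "c (enumerate {i. c i = c k} n) = c k" for n
      using enumerate_in_set[OF inf, of n] by simp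
  qed
qed

text \<open>In a minimal bad sequence infinitely many words begin with the same letter, as there are
  only finitely many letters. Deleting this letter from them gives a bad sequence that is shorter at
  its first changed position, against minimality.\<close>

theorem higman_finite:
  fixes f :: "nat \<Rightarrow> 'a list"
  assumes "finite F" and "\<And>i. set (f i) \<subseteq> F"
  shows "\<exists>i j. i < j \<and> subseq (f i) (f j)"
proof (rule ccontr)
  assume "\<not> ?thesis"
  with assms(2) have "bad_words F f" by (auto simp: bad_words_def)
  then obtain g where bad: "bad_words F g"
    and min: "\<And>n h. bad_words F h \<Longrightarrow> (\<And>i. i < n \<Longrightarrow> h i = g i) \<Longrightarrow> length (g n) \<le> length (h n)"
    by (rule minimal_bad_words) blast
  have incomparable: "\<not> subseq (g i) (g j)" if "i < j" for i j
    using bad that by (auto simp: bad_words_def)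
  have ne: "g i \<noteq> []" for i
    using incomparable[of i "Suc i"] by auto
  have "range (hd \<circ> g) \<subseteq> F"
    using bad ne hd_in_set unfolding bad_words_def by fastforce
  then obtain \<phi> :: "nat \<Rightarrow> nat" and a where mono: "strict_mono \<phi>" and hd: "\<And>n. (hd \<circ> g) (\<phi> n) = a"
    by (rule infinite_constant_subsequence[OF assms(1)]) blast
  define m where "m = \<phi> 0"
  have g_eq: "g (\<phi> n) = a # tl (g (\<phi> n))" for n
    using ne hd by (metis comp_apply list.collapse)
  have m_le: "m \<le> \<phi> n" for n
    using mono by (simp add: m_def strict_mono_less_eq)
  \<comment> \<open>The first \<open>m\<close> words of \<open>g\<close> stay, followed by the tails
    of all words at the positions \<open>\<phi> 0 = m\<close>, \<open>\<phi> 1\<close>, and so on.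
    All these words begin with \<open>a\<close>.\<close>
  define h where "h i = (if i < m then g i else tl (g (\<phi> (i - m))))" for i
  have "bad_words F h"
    unfolding bad_words_def
  proof (intro conjI allI impI notI)
    show "set (h i) \<subseteq> F" for i
      using bad list.set_sel(2)[OF ne, of _ "\<phi> (i - m)"] by (auto simp: h_def bad_words_def)
    fix i j :: nat
    assume "i < j" and sub: "subseq (h i) (h j)"
    \<comment> \<open>An embedding in \<open>h\<close> becomes one in \<open>g\<close>: if only the
      later word was shortened, its letter \<open>a\<close> is put back there; if both were, it is
      put back in both.\<close>
    consider "j < m" | "i < m" "m \<le> j" | "m \<le> i" by linarith
    then show False
    proof cases
      case 1
      then show ?thesis using sub incomparable \<open>i < j\<close> by (simp add: h_def)
    next
      case 2
      then have "subseq (g i) (tl (g (\<phi> (j - m))))" using sub by (simp add: h_def)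
      then have "subseq (g i) (g (\<phi> (j - m)))"
        by (subst g_eq) (rule list_emb_Cons)
      moreover have "i < \<phi> (j - m)" using 2 m_le order_less_le_trans by blast
      ultimately show ?thesis using incomparable by blast
    next
      case 3
      then have "subseq (g (\<phi> (i - m))) (g (\<phi> (j - m)))"
        using sub \<open>i < j\<close> by (subst (1 2) g_eq) (simp add: h_def)
      moreover have "\<phi> (i - m) < \<phi> (j - m)"
        using mono 3 \<open>i < j\<close> by (simp add: strict_mono_less diff_less_mono)
      ultimately show ?thesis using incomparable by blast
    qed
  qed
  moreover have "h i = g i" if "i < m" for i using that by (simp add: h_def)
  ultimately have "length (g m) \<le> length (h m)" by (rule min)
  moreover have "h m = tl (g m)" by (simp add: h_def m_def)
  ultimately show False using ne[of m] by (cases "g m") auto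
qed

text \<open>Infinitely many indices without a related later index would form a subsequence with no
  related pair. So from some bound \<open>b\<close> on every index has a related successor, and a
  chain is built step by step.\<close>

lemma infinite_chain_if_always_good:
  fixes f :: "nat \<Rightarrow> 'a"
  assumes good: "\<And>\<phi> :: nat \<Rightarrow> nat. strict_mono \<phi> \<Longrightarrow> \<exists>i j. i < j \<and> R (f (\<phi> i)) (f (\<phi> j))"
  obtains \<phi> :: "nat \<Rightarrow> nat" where "strict_mono \<phi>" "\<And>n. R (f (\<phi> n)) (f (\<phi> (Suc n)))"
proof -
  define M where "M = {i. \<forall>j>i. \<not> R (f i) (f j)}"
  have "finite M"
  proof (rule ccontr)
    assume inf: "infinite M"
    have mono: "strict_mono (enumerate M)"
      using inf by (rule strict_mono_enumerate)
    from good[OF this] obtain i j where "i < j" "R (f (enumerate M i)) (f (enumerate M j))"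
      by blast
    moreover have "enumerate M i < enumerate M j"
      using mono \<open>i < j\<close> by (simp add: strict_mono_less)
    ultimately show False using enumerate_in_set[OF inf, of i] by (auto simp: M_def)
  qed
  then obtain b where b: "\<And>i. i \<in> M \<Longrightarrow> i < b"
    using finite_nat_set_iff_bounded[of M] by auto
  have "\<exists>j. b \<le> j \<and> i < j \<and> R (f i) (f j)" if "b \<le> i" for i
  proof -
    have "i \<notin> M" using that b by fastforce
    then obtain j where "j > i" "R (f i) (f j)" by (auto simp: M_def)
    then show ?thesis using that by (intro exI[of _ j]) auto
  qed
  then have "\<exists>\<phi>. \<forall>n. b \<le> \<phi> n \<and> \<phi> n < \<phi> (Suc n) \<and> R (f (\<phi> n)) (f (\<phi> (Suc n)))"
    by (intro dependent_nat_choice[of "\<lambda>_ i. b \<le> i" "\<lambda>_ i j. i < j \<and> R (f i) (f j)"]) auto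
  then show ?thesis using that by (auto simp: strict_mono_Suc_iff)
qed

section \<open>The symbols occurring in a tree\<close>

text \<open>The sign is forgotten, so that a dotted edge from a negative literal to its atom changes
  no symbols.\<close>

fun lit_symbols :: "('p, 'f, 'v) literal \<Rightarrow> ('p, 'f) symbol list" where
  "lit_symbols (Pos A) = atom_symbols A"
| "lit_symbols (Neg A) = atom_symbols A"

definition clause_symbols :: "('p, 'f, 'v) clause \<Rightarrow> ('p, 'f) symbol set" where
  "clause_symbols C = set (atom_symbols (head C)) \<union> (\<Union>L\<in>set (body C). set (lit_symbols L))"

lemma trm_symbols_map [simp]: "trm_symbols (map_trm id \<rho> t) = trm_symbols t"
  by (induction t) (simp_all cong: map_cong add: comp_def)

lemma atom_symbols_map [simp]: "atom_symbols (map_atom id id \<rho> A) = atom_symbols A"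
  by (cases A) (simp add: comp_def)

lemma lit_symbols_map [simp]: "lit_symbols (map_literal id id \<rho> L) = lit_symbols L"
  by (cases L) simp_all

lemma clause_symbols_variant: "variant_of C' C \<Longrightarrow> clause_symbols C' = clause_symbols C"
  by (cases C) (auto simp: variant_of_def clause_symbols_def)

lemma PredSym_notin_trm_symbols: "PredSym p \<notin> set (trm_symbols t)"
  by (induction t) auto

lemma PredSym_in_atom_symbols: "PredSym p \<in> set (atom_symbols A) \<longleftrightarrow> p = pred_sym A"
  by (cases A) (auto simp: PredSym_notin_trm_symbols)

text \<open>A symbol string contains exactly one predicate symbol, its first, so an embedding
  already forces equal predicates. Higman's lemma can therefore be applied to whole strings.\<close>

lemma leadsto_loopI:
  assumes "subseq (atom_symbols A) (atom_symbols B)"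
  shows "leadsto_loop A B"
proof -
  have "PredSym (pred_sym A) \<in> set (atom_symbols A)"
    by (simp add: PredSym_in_atom_symbols)
  with assms have "PredSym (pred_sym A) \<in> set (atom_symbols B)"
    by (rule list_emb_set) simp
  then have "pred_sym A = pred_sym B"
    by (simp add: PredSym_in_atom_symbols)
  then show ?thesis using assms by (simp add: leadsto_loop_def)
qed

text \<open>The union over all variables is coarse but sufficient, since \<open>FunSym_mgu\<close>
  bounds an mgu at every variable.\<close>

lemma set_trm_symbols_subst:
  "set (trm_symbols (subst_trm \<sigma> t)) \<subseteq> set (trm_symbols t) \<union> (\<Union>x. set (trm_symbols (\<sigma> x)))"
  by (induction t) fastforce+

lemma set_atom_symbols_subst:
  "set (atom_symbols (subst_atom \<sigma> A)) \<subseteq> set (atom_symbols A) \<union> (\<Union>x. set (trm_symbols (\<sigma> x)))"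
  using set_trm_symbols_subst[of \<sigma>] by (cases A) fastforce

lemma set_lit_symbols_subst:
  "set (lit_symbols (subst_lit \<sigma> L)) \<subseteq> set (lit_symbols L) \<union> (\<Union>x. set (trm_symbols (\<sigma> x)))"
  using set_atom_symbols_subst by (cases L) auto

section \<open>Function symbols in most general unifiers\<close>

lemma FunSym_in_trm_symbols_subst:
  "FunSym f \<in> set (trm_symbols t) \<Longrightarrow> FunSym f \<in> set (trm_symbols (subst_trm \<sigma> t))"
  by (induction t) auto

text \<open>\<open>LNil\<close> serves as replacement because it exists over every signature and
  contributes no \<open>FunSym\<close>.\<close>

primrec prune :: "'f set \<Rightarrow> ('f, 'v) trm \<Rightarrow> ('f, 'v) trm" where
  "prune K (Var x) = Var x"
| "prune K (Fn f ts) = (if f \<in> K then Fn f (map (prune K) ts) else LNil)"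
| "prune K LNil = LNil"
| "prune K (LCons s t) = LCons (prune K s) (prune K t)"

lemma FunSym_in_trm_symbols_prune: "FunSym f \<in> set (trm_symbols (prune K t)) \<Longrightarrow> f \<in> K"
  by (induction t) (auto split: if_splits)

text \<open>Pruning leaves the part of the result that stems from \<open>t\<close> intact, so only
  the values of \<open>\<sigma>\<close> are cut.\<close>

lemma prune_subst_trm:
  "(\<And>f. FunSym f \<in> set (trm_symbols t :: ('p, 'f) symbol list) \<Longrightarrow> f \<in> K) \<Longrightarrow>
   prune K (subst_trm \<sigma> t) = subst_trm (prune K \<circ> \<sigma>) t"
  by (induction t) auto

lemma prune_subst_atom:
  "(\<And>f. FunSym f \<in> set (atom_symbols A) \<Longrightarrow> f \<in> K) \<Longrightarrow>
   subst_atom (prune K \<circ> \<sigma>) A = Atom (pred_sym A) (map (prune K) (args (subst_atom \<sigma> A)))"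
  by (cases A) (auto intro!: prune_subst_trm[symmetric])

text \<open>
  Cutting the foreign function symbols out of an mgu gives another unifier. The latter is an
  instance of the mgu, and instances keep all function symbols.
\<close>

lemma FunSym_mgu:
  assumes mgu: "is_mgu \<theta> A B" and f: "FunSym f \<in> set (trm_symbols (\<theta> x) :: ('p, 'f) symbol list)"
  shows "FunSym f \<in> set (atom_symbols A) \<union> set (atom_symbols B)"
proof -
  define K where "K = {f. FunSym f \<in> set (atom_symbols A) \<union> set (atom_symbols B)}"
  have eq: "subst_atom \<theta> A = subst_atom \<theta> B"
    using mgu by (simp add: is_mgu_def)
  then have "pred_sym A = pred_sym B" by (cases A; cases B) simp
  then have "subst_atom (prune K \<circ> \<theta>) A = subst_atom (prune K \<circ> \<theta>) B"
    using eq by (simp add: prune_subst_atom K_def)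
  then obtain \<delta> where "prune K (\<theta> x) = subst_trm \<delta> (\<theta> x)"
    using mgu unfolding is_mgu_def by fastforce
  then have "FunSym f \<in> set (trm_symbols (prune K (\<theta> x)) :: ('p, 'f) symbol list)"
    using FunSym_in_trm_symbols_subst[OF f] by simp
  then show ?thesis
    using FunSym_in_trm_symbols_prune K_def by fastforce
qed

text \<open>\<open>FunSym_mgu\<close> controls function symbols only; the variable symbol and the
  list symbols are therefore put in outright.\<close>

definition alphabet :: "('p, 'f, 'v) program \<Rightarrow> ('p, 'f, 'v) atom \<Rightarrow> ('p, 'f) symbol set" where
  "alphabet P A0 = {VarSym, LBracket, RBracket, Bar} \<union> set (atom_symbols A0) \<union>
     (\<Union>C\<in>set P. clause_symbols C)"

lemma finite_alphabet: "finite (alphabet P A0)"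
  by (auto simp: alphabet_def clause_symbols_def)

lemma trm_symbols_subset_alphabet:
  fixes P :: "('p, 'f, 'v) program" and t :: "('f, 'w) trm"
  assumes "\<And>f. FunSym f \<in> set (trm_symbols t :: ('p, 'f) symbol list) \<Longrightarrow> FunSym f \<in> alphabet P A0"
  shows "set (trm_symbols t) \<subseteq> alphabet P A0"
proof
  fix s :: "('p, 'f) symbol"
  assume "s \<in> set (trm_symbols t)"
  then show "s \<in> alphabet P A0"
    using assms by - (cases s; auto simp: alphabet_def PredSym_notin_trm_symbols)
qed

text \<open>Induction along the path to the node. Renaming a clause keeps its symbols because all
  variables become \<open>VarSym\<close>, the mgu adds only symbols of the alphabet, and the other
  steps delete literals or drop a sign.\<close>

lemma tree_symbols:
  assumes tree: "generalized_sldnf_tree P A0 T"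
    and "T N = Some (Goal gs)" and "(L, al) \<in> set gs"
  shows "set (lit_symbols L) \<subseteq> alphabet P A0"
  using assms(2,3)
proof (induction N arbitrary: gs L al rule: rev_induct)
  case Nil
  then show ?case using tree by (auto simp: generalized_sldnf_tree_def alphabet_def)
next
  case (snoc s N)
  show ?case
  proof (cases s)
    case Sub
    then have "subsidiary_root T N (Goal gs)"
      using tree snoc.prems(1) by (auto simp: generalized_sldnf_tree_def)
    then show ?thesis using snoc by cases fastforce
  next
    case (Br k)
    then have "child P T N k (Goal gs)"
      using tree snoc.prems(1) by (auto simp: generalized_sldnf_tree_def)
    then show ?thesis
    proof cases
      case (child_resolvent A al' gs' C \<theta>)
      have A: "set (atom_symbols A) \<subseteq> alphabet P A0"
        using snoc.IH[OF child_resolvent(2), of "Pos A" al'] by simp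
      have "clause_symbols C = clause_symbols (P ! k)"
        using child_resolvent by (simp add: clause_symbols_variant)
      then have C: "clause_symbols C \<subseteq> alphabet P A0"
        using child_resolvent by (auto simp: alphabet_def)
      have \<theta>: "set (trm_symbols (\<theta> x)) \<subseteq> alphabet P A0" for x
      proof (rule trm_symbols_subset_alphabet)
        fix f assume "FunSym f \<in> set (trm_symbols (\<theta> x) :: ('a, 'b) symbol list)"
        from FunSym_mgu[OF child_resolvent(6) this] show "FunSym f \<in> alphabet P A0"
          using A C by (auto simp: clause_symbols_def)
      qed
      from snoc.prems(2) child_resolvent(1) obtain L' where "L = subst_lit \<theta> L'"
        and "L' \<in> set (body C) \<or> (L', al) \<in> set gs'"
        by auto
      moreover from this(2) have "set (lit_symbols L') \<subseteq> alphabet P A0"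
        using C snoc.IH[OF child_resolvent(2), of L' al] by (auto simp: clause_symbols_def)
      ultimately show ?thesis using set_lit_symbols_subst \<theta> by blast
    next
      case child_neg_fail
      then show ?thesis using snoc by (meson list.set_intros(2))
    qed
  qed
qed

section \<open>Lasting ancestors\<close>

text \<open>
  The stack holds the ancestor lists of the pending literals. The three kinds of steps are
  resolution, the removal of a failed negative literal, and a dotted edge.
\<close>

lemma lasting_stack_entry:
  fixes W :: "nat \<Rightarrow> 'a set list"
  assumes ne: "\<And>i. W i \<noteq> []"
    and step: "\<And>i. if pos i then \<exists>n. W (Suc i) = replicate n (insert (e i) (hd (W i))) @ tl (W i)
                    else W (Suc i) = tl (W i) \<or> W (Suc i) = W i \<and> pos (Suc i)"
  shows "\<exists>i\<ge>m. pos i \<and> (\<forall>j>i. e i \<in> hd (W j))"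
proof -
  \<comment> \<open>A position of least stack height among those from \<open>m\<close> on.\<close>
  obtain i0 where i0: "i0 \<ge> m" "\<And>j. j \<ge> m \<Longrightarrow> length (W i0) \<le> length (W j)"
    using ex_has_least_nat[of "\<lambda>i. m \<le> i" m "\<lambda>i. length (W i)"] by auto
  have "\<exists>i\<ge>m. pos i \<and> (\<forall>j\<ge>m. length (W i) \<le> length (W j))"
  proof (cases "pos i0")
    case True
    then show ?thesis using i0 by blast
  next
    case False
    \<comment> \<open>At a negative literal a pop would go below the least height, so the step is a
      dotted edge: the height stays and the next selected literal is positive.\<close>
    have "length (W i0) \<le> length (W (Suc i0))" using i0 by simp
    then have "W (Suc i0) \<noteq> tl (W i0)" using ne[of i0] by (cases "W i0") auto
    then have "W (Suc i0) = W i0" "pos (Suc i0)" using step[of i0] False by auto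
    then show ?thesis using i0 by (intro exI[of _ "Suc i0"]) auto
  qed
  then obtain i where i: "i \<ge> m" "pos i" "\<And>j. j \<ge> m \<Longrightarrow> length (W i) \<le> length (W j)" by blast
  \<comment> \<open>The part \<open>tl (W i)\<close> is never touched again, and all entries above
    it descend from step \<open>i\<close>. At least one such entry remains, as the height never
    falls below that of \<open>W i\<close>.\<close>
  have above: "\<exists>X. W j = X @ tl (W i) \<and> (\<forall>a\<in>set X. e i \<in> a) \<and> X \<noteq> []" if "j > i" for j
    using that
  proof (induction j)
    case (Suc j)
    have "\<exists>X. W (Suc j) = X @ tl (W i) \<and> (\<forall>a\<in>set X. e i \<in> a)"
    proof (cases "j = i")
      case True
      then obtain n where "W (Suc j) = replicate n (insert (e i) (hd (W i))) @ tl (W i)"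
        using step[of i] i(2) by auto
      then show ?thesis by (intro exI[of _ "replicate n (insert (e i) (hd (W i)))"]) simp
    next
      case False
      then obtain a X where X: "W j = (a # X) @ tl (W i)" "\<forall>b\<in>set (a # X). e i \<in> b"
        using Suc by (metis less_antisym list.exhaust)
      \<comment> \<open>Only the top entry \<open>a\<close> is consumed, and it contains
        \<open>e i\<close>; hence so does every copy of \<open>insert (e j) a\<close> pushed in its
        place.\<close>
      consider n where "W (Suc j) = replicate n (insert (e j) a) @ X @ tl (W i)"
        | "W (Suc j) = X @ tl (W i)" | "W (Suc j) = W j"
        using step[of j] X(1) by (auto split: if_splits)
      then show ?thesis
      proof cases
        case 1
        then show ?thesis using X(2)
          by (intro exI[of _ "replicate n (insert (e j) a) @ X"]) auto
      next
        case 2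
        then show ?thesis using X(2) by (intro exI[of _ X]) auto
      next
        case 3
        then show ?thesis using X by metis
      qed
    qed
    then obtain X where X: "W (Suc j) = X @ tl (W i)" "\<forall>a\<in>set X. e i \<in> a" by blast
    moreover have "length (W i) \<le> length (W (Suc j))" using i(1,3) Suc.prems by simp
    then have "X \<noteq> []" using X(1) ne[of i] by (cases "W i") auto
    ultimately show ?case by blast
  qed simp
  have "e i \<in> hd (W j)" if "j > i" for j
    using above[OF that] by (metis hd_append2 hd_in_set)
  then show ?thesis using i(1,2) by blast
qed

text \<open>Every node of an infinite path has a successor, so none is a marked leaf or an empty
  goal. After a resolution only the ancestor lists are compared, because the mgu changes the
  literals but not their lists.\<close>

lemma infinite_derivation_goals:
  assumes tree: "generalized_sldnf_tree P A0 T"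
    and path: "\<And>i. edge T (D i) (D (Suc i))"
  obtains L al gs where "\<And>i. T (D i) = Some (Goal ((L i, al i) # gs i))"
    and "\<And>i. if \<exists>A. L i = Pos A
          then D (Suc i) \<noteq> D i @ [Sub] \<and>
            (\<exists>n. map snd ((L (Suc i), al (Suc i)) # gs (Suc i)) =
                 replicate n (insert (D i, L i) (al i)) @ map snd (gs i))
          else if D (Suc i) = D i @ [Sub]
          then (\<exists>A. L (Suc i) = Pos A) \<and> al (Suc i) = al i \<and> gs (Suc i) = []
          else (L (Suc i), al (Suc i)) # gs (Suc i) = gs i"
proof -
  have step: "subsidiary_root T (D i) c \<and> D (Suc i) = D i @ [Sub] \<or>
      (\<exists>k. child P T (D i) k c \<and> D (Suc i) = D i @ [Br k])" if "T (D (Suc i)) = Some c" for i c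
    using tree path[of i] that unfolding generalized_sldnf_tree_def edge_def by metis
  have "\<exists>L al gs. T (D i) = Some (Goal ((L, al) # gs))" for i
  proof -
    obtain c where "T (D (Suc i)) = Some c"
      using path[of i] by (auto simp: edge_def)
    from step[OF this] show ?thesis
      by (elim disjE exE conjE subsidiary_root.cases child.cases) blast+
  qed
  then obtain L al gs where goal: "\<And>i. T (D i) = Some (Goal ((L i, al i) # gs i))"
    by metis
  show ?thesis
  proof (rule that[OF goal])
    fix i
    from step[OF goal[of "Suc i"]]
    show "if \<exists>A. L i = Pos A
          then D (Suc i) \<noteq> D i @ [Sub] \<and>
            (\<exists>n. map snd ((L (Suc i), al (Suc i)) # gs (Suc i)) =
                 replicate n (insert (D i, L i) (al i)) @ map snd (gs i))
          else if D (Suc i) = D i @ [Sub]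
          then (\<exists>A. L (Suc i) = Pos A) \<and> al (Suc i) = al i \<and> gs (Suc i) = []
          else (L (Suc i), al (Suc i)) # gs (Suc i) = gs i"
    proof (elim disjE exE conjE)
      assume "subsidiary_root T (D i) (Goal ((L (Suc i), al (Suc i)) # gs (Suc i)))"
        and "D (Suc i) = D i @ [Sub]"
      then show ?thesis using goal[of i] by cases auto
    next
      fix k
      assume "child P T (D i) k (Goal ((L (Suc i), al (Suc i)) # gs (Suc i)))"
        and D: "D (Suc i) = D i @ [Br k]"
      then show ?thesis
      proof cases
        case (child_resolvent A al' gs' C \<theta>)
        have "map snd ((L (Suc i), al (Suc i)) # gs (Suc i)) =
            replicate (length (body C)) (insert (D i, L i) (al i)) @ map snd (gs i)"
          unfolding child_resolvent(1) using child_resolvent(2) goal[of i]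
          by (simp add: comp_def case_prod_unfold map_replicate_const)
        then show ?thesis using child_resolvent(2) goal[of i] D by auto
      next
        case child_neg_fail
        then show ?thesis using goal[of i] D by auto
      qed
    qed
  qed
qed

lemma lasting_ancestor:
  assumes tree: "generalized_sldnf_tree P A0 T"
    and path: "\<And>i. edge T (D i) (D (Suc i))"
  obtains L al gs where "\<And>i. T (D i) = Some (Goal ((L i, al i) # gs i))"
    and "\<And>m. \<exists>i\<ge>m. (\<exists>A. L i = Pos A) \<and> (\<forall>j>i. (D i, L i) \<in> al j)"
proof -
  obtain L al gs where goal: "\<And>i. T (D i) = Some (Goal ((L i, al i) # gs i))"
    and step: "\<And>i. if \<exists>A. L i = Pos A
          then D (Suc i) \<noteq> D i @ [Sub] \<and>
            (\<exists>n. map snd ((L (Suc i), al (Suc i)) # gs (Suc i)) =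
                 replicate n (insert (D i, L i) (al i)) @ map snd (gs i))
          else if D (Suc i) = D i @ [Sub]
          then (\<exists>A. L (Suc i) = Pos A) \<and> al (Suc i) = al i \<and> gs (Suc i) = []
          else (L (Suc i), al (Suc i)) # gs (Suc i) = gs i"
    using infinite_derivation_goals[of P A0 T D, OF assms] by blast
  \<comment> \<open>The ancestor lists of the literals left behind at dotted edges. Since the path
    never comes back from a subsidiary tree, this stack only grows.\<close>
  define waiting where
    "waiting = rec_nat [] (\<lambda>i w. if D (Suc i) = D i @ [Sub] then map snd (gs i) @ w else w)"
  have waiting_Suc: "waiting (Suc i) =
      (if D (Suc i) = D i @ [Sub] then map snd (gs i) @ waiting i else waiting i)" for i
    by (simp add: waiting_def)
  \<comment> \<open>The current goal lies on top, so \<open>hd (W i)\<close> is the ancestor list of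
    the selected literal. At a dotted edge the remaining literals merely move from the goal to
    \<open>waiting\<close>, which leaves \<open>W\<close> unchanged.\<close>
  define W where "W i = al i # map snd (gs i) @ waiting i" for i
  have "\<exists>i\<ge>m. (\<exists>A. L i = Pos A) \<and> (\<forall>j>i. (D i, L i) \<in> hd (W j))" for m
  proof (rule lasting_stack_entry)
    show "W i \<noteq> []" for i by (simp add: W_def)
    fix i
    show "if \<exists>A. L i = Pos A
          then \<exists>n. W (Suc i) = replicate n (insert (D i, L i) (hd (W i))) @ tl (W i)
          else W (Suc i) = tl (W i) \<or> W (Suc i) = W i \<and> (\<exists>A. L (Suc i) = Pos A)"
    proof (cases "\<exists>A. L i = Pos A")
      case True
      then obtain n where n: "D (Suc i) \<noteq> D i @ [Sub]" "al (Suc i) # map snd (gs (Suc i)) =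
          replicate n (insert (D i, L i) (al i)) @ map snd (gs i)"
        using step[of i] by auto
      then have "W (Suc i) = replicate n (insert (D i, L i) (hd (W i))) @ tl (W i)"
        by (simp add: W_def waiting_Suc flip: append_Cons append_assoc)
      then show ?thesis using True by auto
    next
      case False
      show ?thesis
      proof (cases "D (Suc i) = D i @ [Sub]")
        case True
        then show ?thesis using False step[of i] by (auto simp: W_def waiting_Suc)
      next
        case nosub: False
        then have "(L (Suc i), al (Suc i)) # gs (Suc i) = gs i"
          using False step[of i] by auto
        from this[symmetric] show ?thesis using False nosub by (auto simp: W_def waiting_Suc)
      qed
    qed
  qed
  then show ?thesis using that[OF goal] by (simp add: W_def)
qed

section \<open>Loop goals along infinite derivations\<close>

theorem theorem3p5:
  fixes P :: "('p, 'f, 'v :: infinite) program"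
    and A0 :: "('p, 'f, 'v) atom"
    and T :: "('p, 'f, 'v) gtree"
    and len :: enat
    and D :: "nat \<Rightarrow> name"
  assumes "generalized_sldnf_tree P A0 T"
    and "generalized_sldnf_derivation T len D"
  shows "len = \<infinity> \<longleftrightarrow>
    (\<exists>g :: nat \<Rightarrow> nat. strict_mono g \<and> (\<forall>j. enat (g j) < len) \<and>
       (\<forall>j. loop_goal T (D (g j)) (D (g (Suc j)))))"
proof
  assume "len = \<infinity>"
  with assms(2) have path: "edge T (D i) (D (Suc i))" for i
    by (simp add: generalized_sldnf_derivation_def)
  obtain L al gs where goal: "\<And>i. T (D i) = Some (Goal ((L i, al i) # gs i))"
    and lasting: "\<And>m. \<exists>i\<ge>m. (\<exists>A. L i = Pos A) \<and> (\<forall>j>i. (D i, L i) \<in> al j)"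
    using lasting_ancestor[of P A0 T D, OF assms(1) path] by blast
  \<comment> \<open>The positions of the lasting ancestors. Any two of them are in the ancestor
    relation, so the relation survives passing to a subsequence.\<close>
  define I where "I = {i. (\<exists>A. L i = Pos A) \<and> (\<forall>j>i. (D i, L i) \<in> al j)}"
  have inf: "infinite I"
    using lasting by (auto simp: I_def infinite_nat_iff_unbounded_le)
  define e where "e = enumerate I"
  have e: "strict_mono e" "\<And>k. e k \<in> I"
    using strict_mono_enumerate[OF inf] enumerate_in_set[OF inf] by (simp_all add: e_def)
  have "\<exists>A. L (e k) = Pos A" for k
    using e(2)[of k] by (simp add: I_def)
  then obtain A where A: "\<And>k. L (e k) = Pos (A k)"
    by metis
  have "set (atom_symbols (A k)) \<subseteq> alphabet P A0" for k
    using tree_symbols[OF assms(1) goal, of "L (e k)" "al (e k)" "e k"] A by simp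
  \<comment> \<open>Higman's lemma is needed for every subsequence, as the chain lemma
    requires.\<close>
  then have "\<exists>i j. i < j \<and> subseq (atom_symbols (A (\<phi> i))) (atom_symbols (A (\<phi> j)))" for \<phi> :: "nat \<Rightarrow> nat"
    using higman_finite[OF finite_alphabet, of "\<lambda>i. atom_symbols (A (\<phi> i))" P A0] by blast
  then obtain \<phi> where \<phi>: "strict_mono \<phi>"
    "\<And>n. subseq (atom_symbols (A (\<phi> n))) (atom_symbols (A (\<phi> (Suc n))))"
    using infinite_chain_if_always_good[of "\<lambda>B C. subseq (atom_symbols B) (atom_symbols C)" A]
    by blast
  have mono: "strict_mono (e \<circ> \<phi>)"
    using e(1) \<phi>(1) by (rule strict_mono_o)
  have "loop_goal T (D ((e \<circ> \<phi>) n)) (D ((e \<circ> \<phi>) (Suc n)))" for n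
  proof -
    have "(e \<circ> \<phi>) n < (e \<circ> \<phi>) (Suc n)" using mono by (simp add: strict_mono_Suc_iff)
    then have "(D (e (\<phi> n)), Pos (A (\<phi> n))) \<in> al (e (\<phi> (Suc n)))"
      using e(2)[of "\<phi> n"] A by (auto simp: I_def)
    then show ?thesis
      using goal A leadsto_loopI[OF \<phi>(2)] unfolding loop_goal_def comp_def by metis
  qed
  then show "\<exists>g :: nat \<Rightarrow> nat. strict_mono g \<and> (\<forall>j. enat (g j) < len) \<and>
       (\<forall>j. loop_goal T (D (g j)) (D (g (Suc j))))"
    using mono \<open>len = \<infinity>\<close> by auto
next
  assume "\<exists>g :: nat \<Rightarrow> nat. strict_mono g \<and> (\<forall>j. enat (g j) < len) \<and>
       (\<forall>j. loop_goal T (D (g j)) (D (g (Suc j))))"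
  then obtain g :: "nat \<Rightarrow> nat" where g: "strict_mono g" "\<And>j. enat (g j) < len" by blast
  show "len = \<infinity>"
  proof (cases len)
    case (enat n)
    \<comment> \<open>A strictly increasing \<open>g\<close> satisfies \<open>n \<le> g n\<close>,
      which contradicts \<open>g n < n\<close> for a finite length \<open>n\<close>.\<close>
    then show ?thesis using g(2)[of n] strict_mono_imp_increasing[OF g(1), of n] by simp
  qed simp
qed

end
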